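(* Let $m$ be a linear subspace of $L_2(P^X)$ of finite dimension $D_m$ and let $(\varphi_k)_{k=1}^{D_m}$ be an orthonormal basis of $(m,\|\cdot\|_2)$. (1) If $(\varphi_k)_{k=1}^{D_m}$ is a strongly localized basis, with parameters $r_m$, $b_m$, $(\Pi_i)_{i=1}^{b_m}$, $(A_i)_{i=1}^{b_m}$, $A_c$, then it is a localized basis; more precisely, for every $\beta=(\beta_k)_{k=1}^{D_m}\in\mathbb{R}^{D_m}$, $$\Big\|\sum_{k=1}^{D_m}\beta_k\varphi_k\Big\|_\infty\le A_c r_m\sum_{i=1}^{b_m}\sqrt{A_i}\max_{l\in\Pi_i}|\beta_l|\le A_c r_m^2\sqrt{D_m}\max_{k\in\{1,\dots,D_m\}}|\beta_k|.$$ (2) Reciprocally, if $(\varphi_k)_{k=1}^{D_m}$ is a localized basis with constant $r_\varphi$, then it satisfies properties (i) and (ii) of the definition of a strongly localized basis with $b_m=1$ (so $\Pi_1=\{1,\dots,D_m\}$), $A_1=D_m$ and $r_m=\max\{r_\varphi,1\}$.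
   Context: $\mathcal{X}\subset\mathbb{R}^d$, $P^X$ is a probability measure on $\mathcal{X}$, $\|s\|_2=(\int s^2\,dP^X)^{1/2}$, and $\|\cdot\|_\infty$ is the sup-norm. Strongly localized basis: an orthonormal basis $(\varphi_k)_{k=1}^{D_m}$ of $(m,\|\cdot\|_2)$ is strongly localized if there exist $r_m>0$, $b_m\in\mathbb{N}\setminus\{0\}$, a partition $(\Pi_i)_{i=1}^{b_m}$ of $\{1,\dots,D_m\}$, constants $1\le A_1\le A_2\le\dots\le A_{b_m}<+\infty$ and a constant $A_c>0$ such that: (i) $\sum_{i=1}^{b_m}\sqrt{A_i}\le r_m\sqrt{D_m}$; (ii) for all $i\in\{1,\dots,b_m\}$ and all $k\in\Pi_i$, $\|\varphi_k\|_\infty\le r_m\sqrt{A_i}$; (iii) setting, for $(i,j)\in\{1,\dots,b_m\}^2$ and $k\in\Pi_i$, $\Pi_{j|k}=\{l\in\Pi_j:\ \mathrm{supp}(\varphi_k)\cap\mathrm{supp}(\varphi_l)\ne\emptyset\}$, one has $\max_{k\in\Pi_i}\mathrm{Card}(\Pi_{j|k})\le A_c\max\{A_jA_i^{-1},1\}$ for all $i,j$. Localized basis: an orthonormal basis $(\varphi_k)_{k=1}^{D_m}$ of $(m,\|\cdot\|_2)$ is localized with constant $r_\varphi>0$ if for all $\beta\in\mathbb{R}^{D_m}$, $\|\sum_k\beta_k\varphi_k\|_\infty\le r_\varphi\sqrt{D_m}\max_k|\beta_k|$. *)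

theory Defs
  imports "HOL-Probability.Probability"
begin

text \<open>Elements of \<open>L\<^sub>2(P)\<close> are represented by genuine functions, because sup-norms and
  supports are pointwise notions. The sup-norm and the support are taken over the sample
  space \<open>X\<close>, so values outside \<open>X\<close> play no role.\<close>

definition L2_functions :: "'a measure \<Rightarrow> ('a \<Rightarrow> real) set" where
  "L2_functions P = {f. f \<in> borel_measurable P \<and> integrable P (\<lambda>x. (f x)\<^sup>2)}"

definition L2_inner :: "'a measure \<Rightarrow> ('a \<Rightarrow> real) \<Rightarrow> ('a \<Rightarrow> real) \<Rightarrow> real" where
  "L2_inner P f g = (LINT x|P. f x * g x)"

definition L2_subspace :: "'a measure \<Rightarrow> ('a \<Rightarrow> real) set \<Rightarrow> bool" where
  "L2_subspace P m \<longleftrightarrow>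
     m \<subseteq> L2_functions P \<and> (\<lambda>x. 0) \<in> m \<and>
     (\<forall>f\<in>m. \<forall>g\<in>m. (\<lambda>x. f x + g x) \<in> m) \<and>
     (\<forall>c. \<forall>f\<in>m. (\<lambda>x. c * f x) \<in> m)"

text \<open>Spanning is up to equality almost everywhere, as in \<open>L\<^sub>2(P)\<close>. A family with this property
  forces \<open>m\<close>, modulo equality almost everywhere, to have dimension exactly \<open>D\<close>.\<close>

definition orthonormal_basis ::
  "'a measure \<Rightarrow> ('a \<Rightarrow> real) set \<Rightarrow> nat \<Rightarrow> (nat \<Rightarrow> 'a \<Rightarrow> real) \<Rightarrow> bool" where
  "orthonormal_basis P m D \<phi> \<longleftrightarrow>
     (\<forall>k\<in>{1..D}. \<phi> k \<in> m) \<and>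
     (\<forall>k\<in>{1..D}. \<forall>l\<in>{1..D}. L2_inner P (\<phi> k) (\<phi> l) = (if k = l then 1 else 0)) \<and>
     (\<forall>f\<in>m. \<exists>\<beta>::nat \<Rightarrow> real. AE x in P. f x = (\<Sum>k=1..D. \<beta> k * \<phi> k x))"

text \<open>Extended-real valued, so that unbounded functions have sup-norm \<open>\<infinity>\<close>.\<close>

definition sup_norm :: "'a set \<Rightarrow> ('a \<Rightarrow> real) \<Rightarrow> ereal" where
  "sup_norm X f = (SUP x\<in>X. ereal \<bar>f x\<bar>)"

text \<open>The standing requirements on \<open>r\<close>, \<open>b\<close>, the blocks \<open>B i\<close> (usually written \<open>\<Pi>\<^sub>i\<close>)
  and \<open>A\<close>. With \<^const>\<open>partition_on\<close>, blocks
  are nonempty; injectivity makes differently indexed blocks disjoint.\<close>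

definition sl_parameters ::
  "nat \<Rightarrow> real \<Rightarrow> nat \<Rightarrow> (nat \<Rightarrow> nat set) \<Rightarrow> (nat \<Rightarrow> real) \<Rightarrow> bool" where
  "sl_parameters D r b B A \<longleftrightarrow>
     r > 0 \<and> b \<ge> 1 \<and>
     inj_on B {1..b} \<and> partition_on {1..D} (B ` {1..b}) \<and>
     (\<forall>i\<in>{1..b}. 1 \<le> A i) \<and> mono_on {1..b} A"

definition sl_i :: "nat \<Rightarrow> real \<Rightarrow> nat \<Rightarrow> (nat \<Rightarrow> real) \<Rightarrow> bool" where
  "sl_i D r b A \<longleftrightarrow> (\<Sum>i=1..b. sqrt (A i)) \<le> r * sqrt (real D)"

definition sl_ii ::
  "'a set \<Rightarrow> (nat \<Rightarrow> 'a \<Rightarrow> real) \<Rightarrow> real \<Rightarrow> nat \<Rightarrow> (nat \<Rightarrow> nat set) \<Rightarrow> (nat \<Rightarrow> real) \<Rightarrow> bool" where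
  "sl_ii X \<phi> r b B A \<longleftrightarrow>
     (\<forall>i\<in>{1..b}. \<forall>k\<in>B i. sup_norm X (\<phi> k) \<le> ereal (r * sqrt (A i)))"

text \<open>\<open>meeting X \<phi> B j k\<close> is \<open>\<Pi>\<^bsub>j|k\<^esub>\<close>. The support is the set of points of \<open>X\<close> where the function does
  not vanish; no closure is taken.\<close>

definition meeting ::
  "'a set \<Rightarrow> (nat \<Rightarrow> 'a \<Rightarrow> real) \<Rightarrow> (nat \<Rightarrow> nat set) \<Rightarrow> nat \<Rightarrow> nat \<Rightarrow> nat set" where
  "meeting X \<phi> B j k = {l \<in> B j. support_on X (\<phi> k) \<inter> support_on X (\<phi> l) \<noteq> {}}"

definition sl_iii ::
  "'a set \<Rightarrow> (nat \<Rightarrow> 'a \<Rightarrow> real) \<Rightarrow> nat \<Rightarrow> (nat \<Rightarrow> nat set) \<Rightarrow> (nat \<Rightarrow> real) \<Rightarrow> real \<Rightarrow> bool" where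
  "sl_iii X \<phi> b B A Ac \<longleftrightarrow>
     (\<forall>i\<in>{1..b}. \<forall>j\<in>{1..b}.
        real (Max ((\<lambda>k. card (meeting X \<phi> B j k)) ` B i)) \<le> Ac * max (A j / A i) 1)"

definition strongly_localized_with ::
  "'a set \<Rightarrow> nat \<Rightarrow> (nat \<Rightarrow> 'a \<Rightarrow> real) \<Rightarrow> real \<Rightarrow> nat \<Rightarrow> (nat \<Rightarrow> nat set) \<Rightarrow> (nat \<Rightarrow> real) \<Rightarrow> real \<Rightarrow> bool"
  where
  "strongly_localized_with X D \<phi> r b B A Ac \<longleftrightarrow>
     sl_parameters D r b B A \<and> Ac > 0 \<and>
     sl_i D r b A \<and> sl_ii X \<phi> r b B A \<and> sl_iii X \<phi> b B A Ac"

definition localized_with :: "'a set \<Rightarrow> nat \<Rightarrow> (nat \<Rightarrow> 'a \<Rightarrow> real) \<Rightarrow> real \<Rightarrow> bool" where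
  "localized_with X D \<phi> r \<longleftrightarrow>
     r > 0 \<and>
     (\<forall>\<beta>::nat \<Rightarrow> real.
        sup_norm X (\<lambda>x. \<Sum>k=1..D. \<beta> k * \<phi> k x)
          \<le> ereal (r * sqrt (real D) * Max ((\<lambda>k. \<bar>\<beta> k\<bar>) ` {1..D})))"

definition localized :: "'a set \<Rightarrow> nat \<Rightarrow> (nat \<Rightarrow> 'a \<Rightarrow> real) \<Rightarrow> bool" where
  "localized X D \<phi> \<longleftrightarrow> (\<exists>r. localized_with X D \<phi> r)"

end

theory Submission
  imports Defs
begin

text \<open>At a point \<open>x\<close>, any two functions of the same block \<open>B j\<close> that do not vanish at \<open>x\<close> have
  intersecting supports, so condition (iii) with \<open>i = j\<close> leaves at most \<open>Ac\<close> nonzero terms in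
  each block, each of them bounded through (ii); summing over the blocks and applying (i) gives
  the first part. The converse tests the localization inequality on unit coefficient vectors.\<close>

lemma sup_norm_le_iff: "sup_norm X f \<le> ereal c \<longleftrightarrow> (\<forall>x\<in>X. \<bar>f x\<bar> \<le> c)"
  by (simp add: sup_norm_def SUP_le_iff)

text \<open>Block structure in indexed form: \<open>partition_on\<close> speaks of the set of
  blocks, whereas splitting a sum over the blocks needs a union and pairwise disjointness over the
  indices \<open>1..b\<close>.\<close>

lemma sl_parametersD:
  assumes "sl_parameters D r b B A"
  shows "0 < r" and "{1..D} = (\<Union>i\<in>{1..b}. B i)"
    and "i \<in> {1..b} \<Longrightarrow> finite (B i)" and "i \<in> {1..b} \<Longrightarrow> B i \<noteq> {}"
    and "i \<in> {1..b} \<Longrightarrow> B i \<subseteq> {1..D}"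
    and "i \<in> {1..b} \<Longrightarrow> j \<in> {1..b} \<Longrightarrow> i \<noteq> j \<Longrightarrow> B i \<inter> B j = {}"
    and "i \<in> {1..b} \<Longrightarrow> 1 \<le> A i"
proof -
  have inj: "inj_on B {1..b}" and part: "partition_on {1..D} (B ` {1..b})"
    using assms by (auto simp: sl_parameters_def)
  show "0 < r" "i \<in> {1..b} \<Longrightarrow> 1 \<le> A i" using assms by (auto simp: sl_parameters_def)
  show U: "{1..D} = (\<Union>i\<in>{1..b}. B i)" using part by (auto simp: partition_on_def)
  show sub: "B i \<subseteq> {1..D}" if "i \<in> {1..b}" for i using U that by blast
  show "finite (B i)" if "i \<in> {1..b}" using finite_subset[OF sub[OF that]] by simp
  show "B i \<noteq> {}" if "i \<in> {1..b}" using part that by (force simp: partition_on_def)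
  show "B i \<inter> B j = {}" if ij: "i \<in> {1..b}" "j \<in> {1..b}" "i \<noteq> j"
  proof (rule disjointD)
    show "disjoint (B ` {1..b})" using part by (simp add: partition_on_def)
    show "B i \<noteq> B j" using inj ij by (auto dest: inj_onD)
  qed (use ij in auto)
qed

lemma card_nonvanishing_le:
  assumes "sl_iii X \<phi> b B A Ac" and "j \<in> {1..b}" and "finite (B j)" and "1 \<le> A j"
    and "0 \<le> Ac" and "x \<in> X"
  shows "real (card {l \<in> B j. \<phi> l x \<noteq> 0}) \<le> Ac"
\<comment> \<open>Condition (iii) counts neighbours of a given index, so some nonvanishing index is
  needed as reference; if there is none, the count is 0.\<close>
proof (cases "{l \<in> B j. \<phi> l x \<noteq> 0} = {}")
  case True
  then show ?thesis using \<open>0 \<le> Ac\<close> by (simp only: card.empty of_nat_0)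
next
  case False
  then obtain k where k: "k \<in> B j" "\<phi> k x \<noteq> 0" by blast
  \<comment> \<open>The point \<open>x\<close> itself lies in both supports, so one reference index
    \<open>k\<close> captures all the others.\<close>
  have "{l \<in> B j. \<phi> l x \<noteq> 0} \<subseteq> meeting X \<phi> B j k"
    using k \<open>x \<in> X\<close> by (auto simp: meeting_def support_on_def)
  then have "card {l \<in> B j. \<phi> l x \<noteq> 0} \<le> card (meeting X \<phi> B j k)"
    using \<open>finite (B j)\<close> by (intro card_mono) (auto simp: meeting_def)
  also have "\<dots> \<le> Max ((\<lambda>k. card (meeting X \<phi> B j k)) ` B j)"
    using \<open>finite (B j)\<close> k by (intro Max_ge) auto
  finally have "real (card {l \<in> B j. \<phi> l x \<noteq> 0})
      \<le> real (Max ((\<lambda>k. card (meeting X \<phi> B j k)) ` B j))" by simp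
  also have "\<dots> \<le> Ac * max (A j / A j) 1"
    using assms(1,2) unfolding sl_iii_def by blast
  \<comment> \<open>Within a single block the ratio is 1, since \<open>A j\<close> is
    nonzero.\<close>
  also have "\<dots> = Ac" using \<open>1 \<le> A j\<close> by simp
  finally show ?thesis .
qed

text \<open>Triangle inequality over the nonzero terms only. Here \<open>f k\<close> stands for the
  value of the \<open>k\<close>-th basis function at a fixed point, and \<open>c\<close> for its
  bound from (ii).\<close>

lemma block_sum_le:
  assumes "finite S" and "S \<noteq> {}" and "0 \<le> c"
    and bound: "\<And>k. k \<in> S \<Longrightarrow> \<bar>f k\<bar> \<le> c"
    and card: "real (card {k \<in> S. f k \<noteq> 0}) \<le> Ac"
  shows "\<bar>\<Sum>k\<in>S. \<beta> k * f k\<bar> \<le> Ac * c * Max ((\<lambda>k. \<bar>\<beta> k\<bar>) ` S)"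
proof -
  let ?M = "Max ((\<lambda>k. \<bar>\<beta> k\<bar>) ` S)"
  have M: "\<bar>\<beta> k\<bar> \<le> ?M" if "k \<in> S" for k
    using that \<open>finite S\<close> by (intro Max_ge) auto
  \<comment> \<open>Nonemptiness of \<open>S\<close> matters: \<open>Max\<close> of the empty set is
    unspecified, and the sign is needed to multiply inequalities by \<open>?M\<close>.\<close>
  then have M0: "0 \<le> ?M" using \<open>S \<noteq> {}\<close> by (metis abs_ge_zero ex_in_conv order_trans)
  \<comment> \<open>Discarding the zero terms first lets the cardinality bound \<open>Ac\<close>
    replace the size of the whole block.\<close>
  have "(\<Sum>k\<in>S. \<beta> k * f k) = (\<Sum>k\<in>{k \<in> S. f k \<noteq> 0}. \<beta> k * f k)"
    using \<open>finite S\<close> by (intro sum.mono_neutral_right) auto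
  also have "\<bar>\<dots>\<bar> \<le> (\<Sum>k\<in>{k \<in> S. f k \<noteq> 0}. \<bar>\<beta> k * f k\<bar>)" by (rule sum_abs)
  also have "\<dots> \<le> real (card {k \<in> S. f k \<noteq> 0}) * (?M * c)"
    using M bound M0 by (intro sum_bounded_above) (auto simp: abs_mult intro!: mult_mono)
  also have "\<dots> \<le> Ac * (?M * c)"
    using card M0 \<open>0 \<le> c\<close> by (intro mult_right_mono) auto
  finally show ?thesis by (simp add: ac_simps)
qed

text \<open>At each point of \<open>X\<close> the sum splits along the blocks, and
  \<open>block_sum_le\<close> applies to each block with \<open>c = r * sqrt (A i)\<close>.\<close>

lemma strongly_localized_sup_norm_le:
  assumes "strongly_localized_with X D \<phi> r b B A Ac"
  shows "sup_norm X (\<lambda>x. \<Sum>k=1..D. \<beta> k * \<phi> k x)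
    \<le> ereal (Ac * r * (\<Sum>i=1..b. sqrt (A i) * Max ((\<lambda>l. \<bar>\<beta> l\<bar>) ` B i)))"
  unfolding sup_norm_le_iff
proof
  fix x assume "x \<in> X"
  have params: "sl_parameters D r b B A" and Ac: "Ac > 0"
    and ii: "sl_ii X \<phi> r b B A" and iii: "sl_iii X \<phi> b B A Ac"
    using assms by (auto simp: strongly_localized_with_def)
  note p = sl_parametersD[OF params]
  have block: "\<bar>\<Sum>k\<in>B i. \<beta> k * \<phi> k x\<bar> \<le> Ac * (r * sqrt (A i)) * Max ((\<lambda>l. \<bar>\<beta> l\<bar>) ` B i)"
    if i: "i \<in> {1..b}" for i
  proof (rule block_sum_le)
    show "finite (B i)" "B i \<noteq> {}" using p(3,4)[OF i] .
    show "0 \<le> r * sqrt (A i)" using p(1) p(7)[OF i] by simp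
    show "\<bar>\<phi> k x\<bar> \<le> r * sqrt (A i)" if "k \<in> B i" for k
      using ii i that \<open>x \<in> X\<close> by (auto simp: sl_ii_def sup_norm_le_iff)
    show "real (card {k \<in> B i. \<phi> k x \<noteq> 0}) \<le> Ac"
      using card_nonvanishing_le[OF iii i p(3)[OF i] p(7)[OF i] less_imp_le[OF Ac] \<open>x \<in> X\<close>] .
  qed
  have "(\<Sum>k=1..D. \<beta> k * \<phi> k x) = (\<Sum>i=1..b. \<Sum>k\<in>B i. \<beta> k * \<phi> k x)"
    unfolding p(2) by (rule sum.UNION_disjoint) (use p(3,6) in blast)+
  also have "\<bar>\<dots>\<bar> \<le> (\<Sum>i=1..b. \<bar>\<Sum>k\<in>B i. \<beta> k * \<phi> k x\<bar>)" by (rule sum_abs)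
  also have "\<dots> \<le> (\<Sum>i=1..b. Ac * (r * sqrt (A i)) * Max ((\<lambda>l. \<bar>\<beta> l\<bar>) ` B i))"
    by (rule sum_mono) (rule block)
  also have "\<dots> = Ac * r * (\<Sum>i=1..b. sqrt (A i) * Max ((\<lambda>l. \<bar>\<beta> l\<bar>) ` B i))"
    by (simp add: sum_distrib_left ac_simps)
  finally show "\<bar>\<Sum>k=1..D. \<beta> k * \<phi> k x\<bar>
    \<le> Ac * r * (\<Sum>i=1..b. sqrt (A i) * Max ((\<lambda>l. \<bar>\<beta> l\<bar>) ` B i))" .
qed

text \<open>Each block maximum is dominated by the global one, which factors out; (i) then bounds
  the remaining sum and contributes the second factor \<open>r\<close>.\<close>

lemma strongly_localized_weight_le:
  assumes "strongly_localized_with X D \<phi> r b B A Ac" and "D \<ge> 1"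
  shows "Ac * r * (\<Sum>i=1..b. sqrt (A i) * Max ((\<lambda>l. \<bar>\<beta> l\<bar>) ` B i))
    \<le> Ac * r\<^sup>2 * sqrt (real D) * Max ((\<lambda>k. \<bar>\<beta> k\<bar>) ` {1..D})"
proof -
  let ?M = "Max ((\<lambda>k. \<bar>\<beta> k\<bar>) ` {1..D})"
  have params: "sl_parameters D r b B A" and Ac: "Ac > 0" and i: "sl_i D r b A"
    using assms by (auto simp: strongly_localized_with_def)
  note p = sl_parametersD[OF params]
  \<comment> \<open>Since \<open>D \<ge> 1\<close>, index 1 is available to witness that the global
    maximum is nonnegative.\<close>
  have "\<bar>\<beta> 1\<bar> \<le> ?M" using \<open>D \<ge> 1\<close> by (intro Max_ge) auto
  then have M0: "0 \<le> ?M" by linarith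
  have "(\<Sum>i=1..b. sqrt (A i) * Max ((\<lambda>l. \<bar>\<beta> l\<bar>) ` B i)) \<le> (\<Sum>i=1..b. sqrt (A i) * ?M)"
  proof (rule sum_mono)
    fix i assume i: "i \<in> {1..b}"
    have "Max ((\<lambda>l. \<bar>\<beta> l\<bar>) ` B i) \<le> ?M"
      using p(4,5)[OF i] by (intro Max_mono image_mono) auto
    then show "sqrt (A i) * Max ((\<lambda>l. \<bar>\<beta> l\<bar>) ` B i) \<le> sqrt (A i) * ?M"
      using p(7)[OF i] by (intro mult_left_mono) auto
  qed
  also have "\<dots> = (\<Sum>i=1..b. sqrt (A i)) * ?M" by (simp add: sum_distrib_right)
  also have "\<dots> \<le> r * sqrt (real D) * ?M"
    using i M0 by (intro mult_right_mono) (auto simp: sl_i_def)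
  finally have "Ac * r * (\<Sum>i=1..b. sqrt (A i) * Max ((\<lambda>l. \<bar>\<beta> l\<bar>) ` B i))
      \<le> Ac * r * (r * sqrt (real D) * ?M)"
    using Ac p(1) by (intro mult_left_mono) auto
  then show ?thesis by (simp add: power2_eq_square ac_simps)
qed

lemma strongly_localized_imp_localized:
  assumes "strongly_localized_with X D \<phi> r b B A Ac" and "D \<ge> 1"
  shows "localized X D \<phi>"
proof -
  \<comment> \<open>The localization constant is \<open>Ac * r\<^sup>2\<close>, read off from the
    two preceding bounds.\<close>
  have "0 < Ac * r\<^sup>2"
    using assms by (auto simp: strongly_localized_with_def sl_parameters_def)
  moreover have "sup_norm X (\<lambda>x. \<Sum>k=1..D. \<beta> k * \<phi> k x)
      \<le> ereal (Ac * r\<^sup>2 * sqrt (real D) * Max ((\<lambda>k. \<bar>\<beta> k\<bar>) ` {1..D}))" for \<beta>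
    using strongly_localized_sup_norm_le[OF assms(1), of \<beta>]
      strongly_localized_weight_le[OF assms, of \<beta>]
    by (meson ereal_less_eq(3) order_trans)
  ultimately show ?thesis unfolding localized_def localized_with_def by blast
qed

lemma localized_sup_norm_basis_le:
  assumes "localized_with X D \<phi> r" and "k \<in> {1..D}"
  shows "sup_norm X (\<phi> k) \<le> ereal (r * sqrt (real D))"
proof -
  define \<beta> :: "nat \<Rightarrow> real" where "\<beta> l = of_bool (l = k)" for l
  have "(\<Sum>l=1..D. \<beta> l * \<phi> l x) = \<phi> k x" for x
  proof -
    have "(\<Sum>l=1..D. \<beta> l * \<phi> l x) = (\<Sum>l=1..D. if l = k then \<phi> l x else 0)"
      by (rule sum.cong) (auto simp: \<beta>_def)
    then show ?thesis using \<open>k \<in> {1..D}\<close> by simp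
  qed
  then have "sup_norm X (\<phi> k) \<le> ereal (r * sqrt (real D) * Max ((\<lambda>k. \<bar>\<beta> k\<bar>) ` {1..D}))"
    using assms(1) by (auto simp: localized_with_def dest!: spec[of _ \<beta>])
  \<comment> \<open>The maximum is attained at \<open>l = k\<close>, so the coefficient factor
    disappears from the localization bound.\<close>
  moreover have "Max ((\<lambda>l. \<bar>\<beta> l\<bar>) ` {1..D}) = 1"
    using \<open>k \<in> {1..D}\<close> by (intro Max_eqI) (auto simp: \<beta>_def image_iff intro!: bexI[of _ k])
  ultimately show ?thesis by simp
qed

text \<open>With one index, injectivity and monotonicity are trivial; \<open>D \<ge> 1\<close> makes
  the block nonempty and gives \<open>A 1 = D \<ge> 1\<close>.\<close>

lemma sl_parameters_single_block:
  assumes "D \<ge> 1" and "r > 0"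
  shows "sl_parameters D r 1 (\<lambda>_. {1..D}) (\<lambda>_. real D)"
  using assms by (auto simp: sl_parameters_def partition_on_def mono_on_def)

theorem proposition2p1:
  fixes X :: "(real ^ 'd) set"
    and P :: "(real ^ 'd) measure"
    and m :: "(real ^ 'd \<Rightarrow> real) set"
    and D :: nat
    and \<phi> :: "nat \<Rightarrow> real ^ 'd \<Rightarrow> real"
  assumes "prob_space P"
    and "sets P = sets (restrict_space borel X)"
    and "L2_subspace P m"
    and "D \<ge> 1"
    and "orthonormal_basis P m D \<phi>"
  shows "(\<forall>r b B A Ac. strongly_localized_with X D \<phi> r b B A Ac \<longrightarrow>
            localized X D \<phi> \<and>
            (\<forall>\<beta>::nat \<Rightarrow> real.
               sup_norm X (\<lambda>x. \<Sum>k=1..D. \<beta> k * \<phi> k x)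
                 \<le> ereal (Ac * r * (\<Sum>i=1..b. sqrt (A i) * Max ((\<lambda>l. \<bar>\<beta> l\<bar>) ` B i))) \<and>
               Ac * r * (\<Sum>i=1..b. sqrt (A i) * Max ((\<lambda>l. \<bar>\<beta> l\<bar>) ` B i))
                 \<le> Ac * r\<^sup>2 * sqrt (real D) * Max ((\<lambda>k. \<bar>\<beta> k\<bar>) ` {1..D}))) \<and>
         (\<forall>r\<^sub>\<phi>. localized_with X D \<phi> r\<^sub>\<phi> \<longrightarrow>
            sl_parameters D (max r\<^sub>\<phi> 1) 1 (\<lambda>_. {1..D}) (\<lambda>_. real D) \<and>
            sl_i D (max r\<^sub>\<phi> 1) 1 (\<lambda>_. real D) \<and>
            sl_ii X \<phi> (max r\<^sub>\<phi> 1) 1 (\<lambda>_. {1..D}) (\<lambda>_. real D))"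
proof (intro conjI allI impI)
  fix r b B A Ac \<beta>
  assume sl: "strongly_localized_with X D \<phi> r b B A Ac"
  show "localized X D \<phi>" by (rule strongly_localized_imp_localized[OF sl \<open>D \<ge> 1\<close>])
  show "sup_norm X (\<lambda>x. \<Sum>k=1..D. \<beta> k * \<phi> k x)
      \<le> ereal (Ac * r * (\<Sum>i=1..b. sqrt (A i) * Max ((\<lambda>l. \<bar>\<beta> l\<bar>) ` B i)))"
    by (rule strongly_localized_sup_norm_le[OF sl])
  show "Ac * r * (\<Sum>i=1..b. sqrt (A i) * Max ((\<lambda>l. \<bar>\<beta> l\<bar>) ` B i))
      \<le> Ac * r\<^sup>2 * sqrt (real D) * Max ((\<lambda>k. \<bar>\<beta> k\<bar>) ` {1..D})"
    by (rule strongly_localized_weight_le[OF sl \<open>D \<ge> 1\<close>])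
next
  fix r
  assume loc: "localized_with X D \<phi> r"
  show "sl_parameters D (max r 1) 1 (\<lambda>_. {1..D}) (\<lambda>_. real D)"
    by (rule sl_parameters_single_block) (use \<open>D \<ge> 1\<close> in auto)
  \<comment> \<open>For one block, (i) reads \<open>sqrt D \<le> max r 1 * sqrt D\<close>; this is
    where the maximum with 1 enters.\<close>
  show "sl_i D (max r 1) 1 (\<lambda>_. real D)"
    using mult_right_mono[of 1 "max r 1" "sqrt (real D)"] by (simp add: sl_i_def)
  \<comment> \<open>For (ii), localization gives the bound with \<open>r\<close>, and enlarging the
    constant only weakens it.\<close>
  have "ereal (r * sqrt (real D)) \<le> ereal (max r 1 * sqrt (real D))"
    by (simp add: mult_right_mono)
  then show "sl_ii X \<phi> (max r 1) 1 (\<lambda>_. {1..D}) (\<lambda>_. real D)"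
    unfolding sl_ii_def by (meson localized_sup_norm_basis_le[OF loc] order_trans)
qed

end
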